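(* Let $\mathbb{T}^2=\mathbb{R}^2/\mathbb{Z}^2$ and let $\tau_2:\mathbb{T}^2\to\mathbb{T}^2$ be the orientation-reversing free involution that lifts to the map $\widehat{\tau}_2(x,y)=(x+\tfrac12,1-y)$ of $\mathbb{R}^2$. Let $\beta\in[\mathbb{T}^2,\mathbb{T}^2]$ be a homotopy class and let $$\begin{pmatrix}\beta_{1,1}&\beta_{1,2}\\ \beta_{2,1}&\beta_{2,2}\end{pmatrix}$$ be the integral matrix of the homomorphism $\beta_\#:\pi_1(\mathbb{T}^2)\to\pi_1(\mathbb{T}^2)$ induced by $\beta$, so that, with $\pi_1(\mathbb{T}^2)$ identified with $\mathbb{Z}\oplus\mathbb{Z}$ as specified in the context, $\beta_\#(1,0)=(\beta_{1,1},\beta_{2,1})$ and $\beta_\#(0,1)=(\beta_{1,2},\beta_{2,2})$. Then $\beta$ has the Borsuk-Ulam property with respect to $\tau_2$ if and only if $(\beta_{1,1},\beta_{2,1})\neq(0,0)$, and $\beta_{1,2}$ and $\beta_{2,2}$ are both even.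
   Context: $[M,N]$ denotes the set of free homotopy classes of continuous maps $M\to N$. A homotopy class $\beta\in[M,N]$ has the Borsuk-Ulam property with respect to a free involution $\tau:M\to M$ if for every continuous map $f:M\to N$ with $f\in\beta$ there exists $x\in M$ such that $f(\tau(x))=f(x)$. Since $\pi_1(\mathbb{T}^2)$ is Abelian, each $\beta\in[\mathbb{T}^2,\mathbb{T}^2]$ induces a well-defined endomorphism $\beta_\#$ of $\pi_1(\mathbb{T}^2)$. Identification of $\pi_1(\mathbb{T}^2)$ with $\mathbb{Z}\oplus\mathbb{Z}$ (used for both source and target): $(1,0)$ is the class of the loop $t\mapsto[(0,t)]$, and $(0,1)$ is the class of the loop $t\mapsto[(t,0)]$, $t\in[0,1]$. With this choice, the quotient of $\mathbb{T}^2$ by $\tau_2$ is the Klein bottle $\mathbb{K}^2$ and the map induced on fundamental groups by the double covering $\mathbb{T}^2\to\mathbb{K}^2$ is $(1,0)\mapsto(1,0)$, $(0,1)\mapsto(0,2)$, where $\pi_1(\mathbb{K}^2)=\mathbb{Z}\rtimes\mathbb{Z}$ has the group law $(r_1,s_1)(r_2,s_2)=(r_1+(-1)^{s_1}r_2,s_1+s_2)$. *)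

theory Defs
  imports "HOL-Analysis.Analysis" "HOL-Algebra.Group"
begin

section \<open>Free homotopy classes and the Borsuk-Ulam property\<close>

definition homotopy_classes :: "('a::topological_space \<Rightarrow> 'b::topological_space) set set" where
  "homotopy_classes =
     {f. continuous_on UNIV f} // {(f, g). homotopic_with_canon (\<lambda>_. True) UNIV UNIV f g}"

definition free_involution :: "('a::topological_space \<Rightarrow> 'a) \<Rightarrow> bool" where
  "free_involution \<tau> \<longleftrightarrow> continuous_on UNIV \<tau> \<and> (\<forall>x. \<tau> (\<tau> x) = x) \<and> (\<forall>x. \<tau> x \<noteq> x)"

definition borsuk_ulam_property ::
    "('a::topological_space \<Rightarrow> 'b::topological_space) set \<Rightarrow> ('a \<Rightarrow> 'a) \<Rightarrow> bool" where
  "borsuk_ulam_property \<beta> \<tau> \<longleftrightarrow>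
     (\<forall>f. continuous_on UNIV f \<and> f \<in> \<beta> \<longrightarrow> (\<exists>x. f (\<tau> x) = f x))"


section \<open>The fundamental group\<close>

definition loops_at :: "'a::topological_space \<Rightarrow> (real \<Rightarrow> 'a) set" where
  "loops_at x = {p. path p \<and> pathstart p = x \<and> pathfinish p = x}"

definition path_class :: "(real \<Rightarrow> 'a::topological_space) \<Rightarrow> (real \<Rightarrow> 'a) set" where
  "path_class p = {q. homotopic_paths UNIV p q}"

definition fundamental_group :: "'a::topological_space \<Rightarrow> (real \<Rightarrow> 'a) set monoid" where
  "fundamental_group x =
     \<lparr>carrier = loops_at x // {(p, q). homotopic_paths UNIV p q},
      mult = (\<lambda>C D. {r. \<exists>p\<in>C. \<exists>q\<in>D. homotopic_paths UNIV (p +++ q) r}),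
      one = path_class (\<lambda>_. x)\<rparr>"

lemma homotopic_paths_const_right:
  fixes p :: "real \<Rightarrow> 'a::topological_space"
  assumes "path p"
  shows "homotopic_paths UNIV (p +++ (\<lambda>_. pathfinish p)) p"
proof (rule homotopic_paths_sym, rule homotopic_paths_reparametrize)
  show "continuous_on {0..1} (\<lambda>t::real. min (2 * t) 1)"
    by (intro continuous_intros)
qed (use assms in \<open>auto simp: joinpaths_def pathfinish_def min_def\<close>)

lemma homotopic_paths_const_left:
  fixes p :: "real \<Rightarrow> 'a::topological_space"
  assumes "path p"
  shows "homotopic_paths UNIV ((\<lambda>_. pathstart p) +++ p) p"
proof (rule homotopic_paths_sym, rule homotopic_paths_reparametrize)
  show "continuous_on {0..1} (\<lambda>t::real. max (2 * t - 1) 0)"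
    by (intro continuous_intros)
qed (use assms in \<open>auto simp: joinpaths_def pathstart_def max_def\<close>)

lemma homotopic_paths_reverse_left:
  fixes p :: "real \<Rightarrow> 'a::topological_space"
  assumes "path p"
  shows "homotopic_paths UNIV (reversepath p +++ p) (\<lambda>_. pathfinish p)"
proof -
  let ?u = "\<lambda>(s, t). max s (max (1 - 2 * t) (2 * t - 1)) :: real"
  have "continuous_on ({0..1} \<times> {0..1}) (\<lambda>x. p (?u x))"
    by (rule continuous_on_compose2[OF assms[unfolded path_def]])
      (auto simp: case_prod_unfold intro!: continuous_intros)
  moreover have "p (2 * t - 1) = p (1 - 2 * t)" if "1 \<le> 2 * t" "t * 2 \<le> 1" for t
  proof -
    have "2 * t - 1 = 1 - 2 * t"
      using that by linarith
    then show ?thesis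
      by (simp only:)
  qed
  ultimately show ?thesis
    unfolding homotopic_paths
    by (intro exI[of _ "\<lambda>x. p (?u x)"])
      (auto simp: joinpaths_def reversepath_def pathstart_def pathfinish_def max_def)
qed

lemma path_class_eq_iff:
  assumes "path p"
  shows "path_class p = path_class q \<longleftrightarrow> homotopic_paths UNIV p q"
proof
  assume "path_class p = path_class q"
  moreover have "p \<in> path_class p"
    using assms by (simp add: path_class_def)
  ultimately show "homotopic_paths UNIV p q"
    by (simp add: path_class_def homotopic_paths_sym)
next
  assume "homotopic_paths UNIV p q"
  then show "path_class p = path_class q"
    unfolding path_class_def by (blast intro: homotopic_paths_trans homotopic_paths_sym)
qed

lemma carrier_fundamental_group: "carrier (fundamental_group x) = path_class ` loops_at x"
  by (auto simp: fundamental_group_def quotient_def path_class_def)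

lemma mult_fundamental_group:
  assumes "p \<in> loops_at x" "q \<in> loops_at x"
  shows "path_class p \<otimes>\<^bsub>fundamental_group x\<^esub> path_class q = path_class (p +++ q)"
proof -
  have "homotopic_paths UNIV (p +++ q) (p' +++ q')"
    if "homotopic_paths UNIV p p'" "homotopic_paths UNIV q q'" for p' q'
    using that assms by (intro homotopic_paths_join) (auto simp: loops_at_def)
  moreover have "homotopic_paths UNIV p p" "homotopic_paths UNIV q q"
    using assms by (auto simp: loops_at_def)
  ultimately show ?thesis
    unfolding fundamental_group_def path_class_def monoid.simps mem_Collect_eq
    by (blast intro: homotopic_paths_trans)
qed

lemma group_fundamental_group: "group (fundamental_group x)"
proof (rule groupI)
  fix C D assume "C \<in> carrier (fundamental_group x)" "D \<in> carrier (fundamental_group x)"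
  then show "C \<otimes>\<^bsub>fundamental_group x\<^esub> D \<in> carrier (fundamental_group x)"
    by (auto simp: carrier_fundamental_group mult_fundamental_group loops_at_def)
next
  show "\<one>\<^bsub>fundamental_group x\<^esub> \<in> carrier (fundamental_group x)"
    by (auto simp: carrier_fundamental_group)
      (auto simp: fundamental_group_def loops_at_def path_def pathstart_def pathfinish_def)
next
  fix C D E
  assume "C \<in> carrier (fundamental_group x)" "D \<in> carrier (fundamental_group x)"
    "E \<in> carrier (fundamental_group x)"
  then obtain p q r where pqr: "p \<in> loops_at x" "q \<in> loops_at x" "r \<in> loops_at x"
    and CDE: "C = path_class p" "D = path_class q" "E = path_class r"
    by (auto simp: carrier_fundamental_group)
  have "p +++ q \<in> loops_at x" "q +++ r \<in> loops_at x"
    using pqr by (auto simp: loops_at_def)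
  moreover have "path_class ((p +++ q) +++ r) = path_class (p +++ q +++ r)"
    using pqr by (subst path_class_eq_iff)
      (auto simp: loops_at_def intro!: homotopic_paths_sym[OF homotopic_paths_assoc])
  ultimately show "C \<otimes>\<^bsub>fundamental_group x\<^esub> D \<otimes>\<^bsub>fundamental_group x\<^esub> E =
      C \<otimes>\<^bsub>fundamental_group x\<^esub> (D \<otimes>\<^bsub>fundamental_group x\<^esub> E)"
    using pqr by (simp add: CDE mult_fundamental_group)
next
  fix C assume "C \<in> carrier (fundamental_group x)"
  then obtain p where p: "p \<in> loops_at x" "C = path_class p"
    by (auto simp: carrier_fundamental_group)
  have const: "(\<lambda>_. x) \<in> loops_at x"
    by (auto simp: loops_at_def path_def pathstart_def pathfinish_def)
  have one: "\<one>\<^bsub>fundamental_group x\<^esub> = path_class (\<lambda>_. x)"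
    by (simp add: fundamental_group_def)
  have "path_class ((\<lambda>_. x) +++ p) = path_class p"
    using p const homotopic_paths_const_left[of p]
    by (subst path_class_eq_iff) (auto simp: loops_at_def)
  then show "\<one>\<^bsub>fundamental_group x\<^esub> \<otimes>\<^bsub>fundamental_group x\<^esub> C = C"
    using p const by (simp add: one mult_fundamental_group)
  have rev: "reversepath p \<in> loops_at x"
    using p by (auto simp: loops_at_def)
  have "path_class (reversepath p +++ p) = path_class (\<lambda>_. x)"
    using p homotopic_paths_reverse_left[of p]
    by (subst path_class_eq_iff) (auto simp: loops_at_def)
  then show "\<exists>D\<in>carrier (fundamental_group x).
      D \<otimes>\<^bsub>fundamental_group x\<^esub> C = \<one>\<^bsub>fundamental_group x\<^esub>"
    using p rev by (auto simp: one mult_fundamental_group carrier_fundamental_group)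
qed

text \<open>
  The maps in a free homotopy class need not preserve base points, so the image of a loop is
  carried back to the base point \<open>y\<close> along a path \<open>\<gamma>\<close>. All choices of \<open>f\<close>, \<open>p\<close> and \<open>\<gamma>\<close> are
  collected; if the fundamental group of the (path connected) target is Abelian, they all give the
  same element, and the resulting set is that element.
\<close>

definition induced_hom ::
    "'b::topological_space \<Rightarrow> ('a::topological_space \<Rightarrow> 'b) set \<Rightarrow> (real \<Rightarrow> 'a) set \<Rightarrow> (real \<Rightarrow> 'b) set"
  where
  "induced_hom y \<beta> C =
     {r. \<exists>f\<in>\<beta>. \<exists>p\<in>C. \<exists>\<gamma>. path \<gamma> \<and> pathstart \<gamma> = y \<and> pathfinish \<gamma> = f (pathstart p) \<and>
         homotopic_paths UNIV (\<gamma> +++ (f \<circ> p) +++ reversepath \<gamma>) r}"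


section \<open>The torus\<close>

definition lattice_rel :: "real \<times> real \<Rightarrow> real \<times> real \<Rightarrow> bool" where
  "lattice_rel p q \<longleftrightarrow> fst p - fst q \<in> \<int> \<and> snd p - snd q \<in> \<int>"

lemma equivp_lattice_rel: "equivp lattice_rel"
proof (rule equivpI)
  show "reflp lattice_rel"
    by (simp add: reflp_def lattice_rel_def)
  have "lattice_rel q p" if "lattice_rel p q" for p q
    using that Ints_minus[of "fst p - fst q"] Ints_minus[of "snd p - snd q"]
    by (simp add: lattice_rel_def)
  then show "symp lattice_rel"
    by (rule sympI)
  have "lattice_rel p r" if "lattice_rel p q" "lattice_rel q r" for p q r
    using that Ints_add[of "fst p - fst q" "fst q - fst r"] Ints_add[of "snd p - snd q" "snd q - snd r"]
    by (simp add: lattice_rel_def)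
  then show "transp lattice_rel"
    by (rule transpI)
qed

quotient_type torus = "real \<times> real" / lattice_rel
  morphisms rep_torus to_torus
  by (rule equivp_lattice_rel)

instantiation torus :: topological_space
begin

definition open_torus :: "torus set \<Rightarrow> bool" where
  "open_torus U \<longleftrightarrow> open (to_torus -` U)"

instance
proof
  show "open (UNIV :: torus set)"
    by (simp add: open_torus_def)
  show "open (S \<inter> T)" if "open S" "open T" for S T :: "torus set"
    using that by (simp add: open_torus_def vimage_Int open_Int)
  show "open (\<Union>K)" if "\<forall>S\<in>K. open S" for K :: "torus set set"
    using that by (auto simp: open_torus_def vimage_Union)
qed

end

lemma to_torus_eq_iff:
  "to_torus p = to_torus q \<longleftrightarrow> fst p - fst q \<in> \<int> \<and> snd p - snd q \<in> \<int>"
  by (simp add: torus.abs_eq_iff lattice_rel_def)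

lemma continuous_on_to_torus: "continuous_on UNIV to_torus"
  by (simp add: continuous_on_open_vimage open_torus_def)

lemma continuous_on_torusI:
  fixes f :: "torus \<Rightarrow> 'a::topological_space"
  assumes "continuous_on UNIV (\<lambda>p. f (to_torus p))"
  shows "continuous_on UNIV f"
  using assms by (simp add: continuous_on_open_vimage open_torus_def vimage_def)

lift_definition tau2 :: "torus \<Rightarrow> torus" is "\<lambda>(x, y). (x + 1/2, 1 - y)"
proof -
  fix p q :: "real \<times> real"
  assume "lattice_rel p q"
  then have "fst p - fst q \<in> \<int>" "- (snd p - snd q) \<in> \<int>"
    unfolding lattice_rel_def by (blast intro: Ints_minus)+
  then show "lattice_rel (case p of (x, y) \<Rightarrow> (x + 1/2, 1 - y)) (case q of (x, y) \<Rightarrow> (x + 1/2, 1 - y))"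
    by (simp add: lattice_rel_def case_prod_unfold)
qed

lemma free_involution_tau2: "free_involution tau2"
  unfolding free_involution_def
proof (intro conjI allI)
  have "continuous_on UNIV (\<lambda>p. to_torus (fst p + 1/2, 1 - snd p))"
    by (rule continuous_on_compose2[OF continuous_on_to_torus]) (auto intro!: continuous_intros)
  then show "continuous_on UNIV tau2"
    by (intro continuous_on_torusI) (simp add: tau2.abs_eq case_prod_unfold)
next
  fix t :: torus
  obtain x y where t: "t = to_torus (x, y)"
    by (induction t rule: torus.abs_induct) auto
  show "tau2 (tau2 t) = t"
    by (simp add: t tau2.abs_eq to_torus_eq_iff)
  have "(1/2 :: real) \<notin> \<int>"
    by simp
  then show "tau2 t \<noteq> t"
    by (simp add: t tau2.abs_eq to_torus_eq_iff)
qed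

definition base :: torus where
  "base = to_torus (0, 0)"

definition torus_pi1 :: "(real \<Rightarrow> torus) set monoid" where
  "torus_pi1 = fundamental_group base"

text \<open>
  The identification of the integer pairs with the fundamental group of the torus. Note the order:
  the first generator runs in the direction of the second coordinate.
\<close>

definition pi1_of :: "int \<times> int \<Rightarrow> (real \<Rightarrow> torus) set" where
  "pi1_of = (\<lambda>(m, n).
     (path_class (\<lambda>t. to_torus (0, t)) [^]\<^bsub>torus_pi1\<^esub> m) \<otimes>\<^bsub>torus_pi1\<^esub>
     (path_class (\<lambda>t. to_torus (t, 0)) [^]\<^bsub>torus_pi1\<^esub> n))"

text \<open>
  The columns of \<open>A\<close> are the images of the generators under the induced endomorphism.
\<close>

definition is_matrix_of :: "(torus \<Rightarrow> torus) set \<Rightarrow> int^2^2 \<Rightarrow> bool" where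
  "is_matrix_of \<beta> A \<longleftrightarrow>
     induced_hom base \<beta> (pi1_of (1, 0)) = pi1_of (A $ 1 $ 1, A $ 2 $ 1) \<and>
     induced_hom base \<beta> (pi1_of (0, 1)) = pi1_of (A $ 1 $ 2, A $ 2 $ 2)"

end

theory Submission
  imports Defs "HOL-Complex_Analysis.Winding_Numbers"
begin

text \<open>
  A map \<open>f\<close> of the torus lifts to a map \<open>F\<close> of the plane, and the matrix of its homotopy class records
  the vectors \<open>a\<close> and \<open>b\<close> by which \<open>F\<close> is shifted under the unit translations in the directions of
  \<open>x\<close> and \<open>y\<close> (\<open>induced_hom_displacement\<close>). The involution lifts to the glide reflection
  \<open>\<tau>(x, y) = (x + 1/2, 1 - y)\<close>, and \<open>f\<close> has a coincidence if and only if \<open>G(v) = F(\<tau>v) - F(v)\<close> takes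
  a value in the lattice \<open>\<int>\<^sup>2\<close>. This difference satisfies
  \<open>G(x + 1, y) = G(x, y)\<close>, \<open>G(x, y + 1) = G(x, y) - 2b\<close> and \<open>G(\<tau>v) = a - G(v)\<close>; conversely every
  continuous \<open>G\<close> with these symmetries arises from a map homotopic to \<open>f\<close>. So the question is whether
  such a \<open>G\<close> can avoid the lattice. The claim is that it cannot exactly if \<open>b \<noteq> 0\<close> and
  \<open>a/2\<close> is a lattice point, that is, both entries of the column \<open>a\<close> are even.

  If \<open>b \<noteq> 0\<close> and \<open>a/2\<close> is a lattice point, consider the loops \<open>x \<mapsto> G(x, y)\<close>. If \<open>G\<close> avoided
  the lattice, their winding number about each lattice point would be independent of \<open>y\<close>, and, by the
  shift under \<open>y \<mapsto> y + 1\<close>, the same about all the points \<open>a/2 + 2kb\<close>. About \<open>a/2\<close> it is odd,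
  because \<open>G - a/2\<close> is antiperiodic on the line \<open>y = 1/2\<close>; far away it is zero. This
  contradiction is \<open>odd_quasiperiodic_map_hits_multiple\<close>.

  In the remaining cases explicit maps \<open>G\<close> avoid the lattice (\<open>equivariant_map_avoiding_lattice\<close>):
  a circle about \<open>a/2\<close> if \<open>b = 0\<close> and \<open>a/2\<close> is a lattice point, and a path through the points
  \<open>a/2 + kb\<close>, with \<open>k\<close> an integer, if \<open>a/2\<close> is not a lattice point.
\<close>

section \<open>Odd maps of the plane\<close>

lemma continuous_integer_valued_constant:
  fixes f :: "'a::topological_space \<Rightarrow> real"
  assumes "connected S" "continuous_on S f" "\<And>x. x \<in> S \<Longrightarrow> f x \<in> \<int>" "x \<in> S" "y \<in> S"
  shows "f x = f y"
proof -
  have "f constant_on S"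
  proof (rule continuous_discrete_range_constant[OF assms(1,2)])
    fix x assume "x \<in> S"
    have "1 \<le> norm (f y - f x)" if "y \<in> S" "f y \<noteq> f x" for y
      using Ints_nonzero_abs_ge1[of "f y - f x"] that assms(3) \<open>x \<in> S\<close> by auto
    then show "\<exists>e>0. \<forall>y. y \<in> S \<and> f y \<noteq> f x \<longrightarrow> e \<le> norm (f y - f x)"
      using zero_less_one by blast
  qed
  then show ?thesis
    using assms(4,5) by (auto simp: constant_on_def)
qed

text \<open>
  A continuous logarithm \<open>L\<close> of \<open>\<gamma>\<close> grows over half a period by an odd multiple of \<open>\<pi>\<i>\<close>. This
  multiple depends continuously on the starting point, so it is the same for the two halves of
  the period, and together they contribute an odd multiple of \<open>2\<pi>\<i>\<close>.
\<close>

lemma winding_number_antiperiodic_odd: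
  fixes \<gamma> :: "real \<Rightarrow> complex"
  assumes cont: "continuous_on UNIV \<gamma>" and anti: "\<And>x. \<gamma> (x + 1/2) = - \<gamma> x"
    and nz: "\<And>x. \<gamma> x \<noteq> 0"
  obtains n :: int where "winding_number \<gamma> 0 = 2 * of_int n + 1"
proof -
  obtain L where L: "continuous_on UNIV L" "\<And>x. \<gamma> x = exp (L x)"
    using continuous_logarithm_on_contractible[OF cont] nz
    by (metis UNIV_I contractible_UNIV)
  define d where "d x = (Im (L (x + 1/2)) - Im (L x)) / (2 * pi) - 1/2" for x
  have step: "L (x + 1/2) = L x + of_real (2 * pi * d x + pi) * \<i> \<and> d x \<in> \<int>" for x
  proof -
    have "exp (L (x + 1/2)) = exp (L x + of_real pi * \<i>)"
      using anti[of x] by (simp add: L(2) exp_add)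
    then obtain n :: int where n: "L (x + 1/2) = L x + of_real pi * \<i> + of_int (2 * n) * of_real pi * \<i>"
      by (auto simp: exp_eq)
    then have "d x = of_int n"
      by (simp add: d_def field_simps)
    then show ?thesis
      by (simp add: n algebra_simps)
  qed
  have "continuous_on UNIV d"
    unfolding d_def by (intro continuous_intros continuous_on_compose2[OF L(1)]) auto
  then have "d 0 = d (1/2)"
    using continuous_integer_valued_constant[of UNIV d] step by auto
  then have "L 1 - L 0 = (2 * of_real (d 0) + 1) * (2 * of_real pi * \<i>)"
    using step[of 0] step[of "1/2"] by (simp add: algebra_simps)
  moreover have "winding_number (exp \<circ> L) 0 = (L 1 - L 0) / (2 * of_real pi * \<i>)"
    using winding_number_compose_exp[of L] continuous_on_subset[OF L(1)]
    by (simp add: path_def pathstart_def pathfinish_def)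
  moreover have "exp \<circ> L = \<gamma>"
    by (simp add: L(2) fun_eq_iff)
  ultimately have "winding_number \<gamma> 0 = (2 * of_real (d 0) + 1) * (2 * of_real pi * \<i>) / (2 * of_real pi * \<i>)"
    by metis
  then have "winding_number \<gamma> 0 = 2 * of_real (d 0) + 1"
    by simp
  moreover obtain n where "d 0 = of_int n"
    using step[of 0] by (auto elim: Ints_cases)
  ultimately show thesis
    using that[of n] by simp
qed

text \<open>
  This is the obstruction to removing coincidences. Suppose that \<open>H\<close> misses every \<open>2kb\<close>. Then the
  winding number about \<open>2kb\<close> of the loop \<open>x \<mapsto> H(x, y)\<close> does not depend on \<open>y\<close>. Passing from
  \<open>y = 0\<close> to \<open>y = 1\<close> translates the loop by \<open>-2b\<close>, so the winding number does not depend on \<open>k\<close>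
  either. It is odd for \<open>k = 0\<close>, because on the line \<open>y = 1/2\<close> the symmetry of \<open>H\<close> says that the loop
  is antiperiodic; but it vanishes for large \<open>k\<close>, because a loop is bounded.
\<close>

lemma odd_quasiperiodic_map_hits_multiple:
  fixes H :: "real \<times> real \<Rightarrow> complex"
  assumes cont: "continuous_on UNIV H" and b: "b \<noteq> 0"
    and perx: "\<And>x y. H (x + 1, y) = H (x, y)"
    and pery: "\<And>x y. H (x, y + 1) = H (x, y) - 2 * b"
    and odd: "\<And>x y. H (x + 1/2, 1 - y) = - H (x, y)"
  obtains v and k :: nat where "H v = 2 * of_nat k * b"
proof (rule ccontr)
  assume "\<not> thesis"
  then have avoid: "H v \<noteq> 2 * of_nat k * b" for v and k :: nat
    using that by blast
  define W where "W y = winding_number (\<lambda>x. H (x, y))" for y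
  have loop: "path (\<lambda>x. H (x, y))" "pathfinish (\<lambda>x. H (x, y)) = pathstart (\<lambda>x. H (x, y))" for y
    using perx[of 0 y]
    by (auto simp: path_def pathstart_def pathfinish_def
        intro!: continuous_on_compose2[OF cont] continuous_intros)
  have homotopy: "W y (2 * of_nat k * b) = W y' (2 * of_nat k * b)" for y y' and k :: nat
    unfolding W_def
  proof (rule winding_number_homotopic_loops)
    let ?h = "\<lambda>(t, x). H (x, y + t * (y' - y))"
    have "continuous_on ({0..1} \<times> {0..1}) ?h"
      unfolding case_prod_unfold
      by (intro continuous_on_compose2[OF cont] continuous_intros) auto
    moreover have "pathfinish (?h \<circ> Pair t) = pathstart (?h \<circ> Pair t)" for t
      using perx[of 0] by (simp add: pathstart_def pathfinish_def)
    ultimately show "homotopic_loops (- {2 * of_nat k * b}) (\<lambda>x. H (x, y)) (\<lambda>x. H (x, y'))"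
      unfolding homotopic_loops using avoid by (intro exI[of _ ?h]) auto
  qed
  have shift: "W 1 z = W 0 (z + 2 * b)" for z
  proof -
    have "H (x, 1) = H (x, 0) - 2 * b" for x
      using pery[of x 0] by simp
    then have "W 1 z = winding_number (\<lambda>x. H (x, 0) - 2 * b) z"
      by (simp only: W_def)
    also have "\<dots> = winding_number (\<lambda>x. H (x, 0) - 2 * b - z) 0"
      by (rule winding_number_offset)
    also have "\<dots> = W 0 (z + 2 * b)"
      unfolding W_def winding_number_offset[of "\<lambda>x. H (x, 0)" "z + 2 * b"]
      by (simp add: diff_diff_eq add.commute)
    finally show ?thesis .
  qed
  have const: "W 0 (2 * of_nat k * b) = W 0 0" for k :: nat
  proof (induction k)
    case (Suc k)
    have "W 0 (2 * of_nat (Suc k) * b) = W 1 (2 * of_nat k * b)"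
      by (simp add: shift algebra_simps)
    then show ?case
      using Suc homotopy[of 1 k 0] by simp
  qed simp
  obtain n :: int where "W (1/2) 0 = 2 * of_int n + 1"
    unfolding W_def
  proof (rule winding_number_antiperiodic_odd[of "\<lambda>x. H (x, 1/2)"])
    show "continuous_on UNIV (\<lambda>x. H (x, 1/2))"
      by (intro continuous_on_compose2[OF cont] continuous_intros) simp
    show "H (x + 1/2, 1/2) = - H (x, 1/2)" for x
      using odd[of x "1/2"] by simp
    show "H (x, 1/2) \<noteq> 0" for x
      using avoid[of _ 0] by simp
  qed
  then have "W 0 0 = of_int (2 * n + 1)"
    using homotopy[of "1/2" 0 0] by simp
  moreover have "2 * n + 1 \<noteq> 0"
    by presburger
  then have "of_int (2 * n + 1) \<noteq> (0 :: complex)"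
    unfolding of_int_eq_0_iff .
  ultimately have "W 0 0 \<noteq> 0"
    by (rule ssubst)
  moreover obtain B where B: "\<And>z. B \<le> norm z \<Longrightarrow> W 0 z = 0"
    using winding_number_zero_at_infinity[OF loop, of 0] unfolding W_def by blast
  obtain k :: nat where "B / norm (2 * b) \<le> of_nat k"
    using real_arch_simple by blast
  then have "B \<le> norm (2 * of_nat k * b)"
    using b by (simp add: norm_mult field_simps)
  ultimately show False
    using B[of "2 * of_nat k * b"] const[of k] by simp
qed

text \<open>
  The symmetries imposed on \<open>G\<close> are those of \<open>v \<mapsto> F(\<tau>v) - F(v)\<close> when \<open>F\<close> lifts a self-map of the
  torus, shifted by \<open>a\<close> and \<open>b\<close> under the two unit translations, and \<open>\<tau>\<close> is the lift of the involution.
  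
  The point \<open>a/2\<close> is the centre of symmetry. If it is a lattice point, then \<open>b = 0\<close> and \<open>G\<close> may go
  round it on a circle of radius 1/2. Otherwise the centre and its translates by multiples of \<open>b\<close>,
  which \<open>G\<close> takes as values for \<open>2y \<in> \<int>\<close>, are harmless, and only the segments between them may
  meet the lattice; they are bent away from it.
\<close>

lemma equivariant_map_avoiding_lattice:
  fixes a b :: "real \<times> real"
  assumes a: "a \<in> \<int> \<times> \<int>" and b: "b \<in> \<int> \<times> \<int>" and ab: "b = 0 \<or> a /\<^sub>R 2 \<notin> \<int> \<times> \<int>"
  obtains G :: "real \<times> real \<Rightarrow> real \<times> real" where "continuous_on UNIV G"
    "\<And>x y. G (x + 1, y) = G (x, y)" "\<And>x y. G (x, y + 1) = G (x, y) - 2 *\<^sub>R b"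
    "\<And>x y. G (x + 1/2, 1 - y) = a - G (x, y)" "\<And>v. G v \<notin> \<int> \<times> \<int>"
proof (cases "a /\<^sub>R 2 \<in> \<int> \<times> \<int>")
  case True
  define G where "G = (\<lambda>v::real \<times> real. a /\<^sub>R 2 + (cos (2 * pi * fst v) / 2, sin (2 * pi * fst v) / 2))"
  have zero: "r = 0" if "r / 2 \<in> \<int>" "\<bar>r\<bar> \<le> 1" for r :: real
    using Ints_nonzero_abs_ge1[of "r / 2"] that by auto
  have arg: "2 * pi * (x + 1) = 2 * pi * x + 2 * pi" "2 * pi * (x + 1/2) = 2 * pi * x + pi" for x
    by (simp_all add: algebra_simps)
  show thesis
  proof
    show "continuous_on UNIV G"
      unfolding G_def by (intro continuous_intros) simp_all
    show "G (x + 1, y) = G (x, y)" for x y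
      by (simp only: G_def fst_conv arg) simp
    show "G (x, y + 1) = G (x, y) - 2 *\<^sub>R b" for x y
      using ab True by (simp add: G_def)
    show "G (x + 1/2, 1 - y) = a - G (x, y)" for x y
      by (simp only: G_def fst_conv arg) (simp add: prod_eq_iff)
    show "G v \<notin> \<int> \<times> \<int>" for v
    proof
      assume "G v \<in> \<int> \<times> \<int>"
      then have "G v - a /\<^sub>R 2 \<in> \<int> \<times> \<int>"
        using True by (auto simp: mem_Times_iff)
      then have "cos (2 * pi * fst v) = 0" "sin (2 * pi * fst v) = 0"
        by (auto simp: G_def intro!: zero)
      then show False
        using sin_cos_squared_add[of "2 * pi * fst v"] by simp
    qed
  qed
next
  case False
  define N where "N = (fst b)\<^sup>2 + (snd b)\<^sup>2"
  \<comment> \<open>The vector \<open>w\<close> is orthogonal to \<open>b\<close>, and its length makes the determinant of \<open>b\<close> and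
    \<open>G v - a/2\<close> equal to a quarter of the sine. At lattice points that determinant is a multiple of 1/2,
    so the sine vanishes there. For \<open>b = 0\<close> division by zero gives \<open>w = 0\<close>, and \<open>G\<close> is constant.\<close>
  define w where "w = (- snd b / (4 * N), fst b / (4 * N))"
  define G where "G = (\<lambda>v::real \<times> real. a /\<^sub>R 2 + (1 - 2 * snd v) *\<^sub>R b + sin (2 * pi * snd v) *\<^sub>R w)"
  have arg: "2 * pi * (y + 1) = 2 * pi * y + 2 * pi" "2 * pi * (1 - y) = 2 * pi - 2 * pi * y" for y
    by (simp_all add: algebra_simps)
  show thesis
  proof
    show "continuous_on UNIV G"
      unfolding G_def by (intro continuous_intros)
    show "G (x + 1, y) = G (x, y)" for x y
      by (simp add: G_def)
    show "G (x, y + 1) = G (x, y) - 2 *\<^sub>R b" for x y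
    proof -
      have "sin (2 * pi * (y + 1)) = sin (2 * pi * y)"
        unfolding arg by (rule sin_periodic)
      then show ?thesis
        by (simp add: G_def prod_eq_iff algebra_simps)
    qed
    show "G (x + 1/2, 1 - y) = a - G (x, y)" for x y
    proof -
      have "sin (2 * pi * (1 - y)) = - sin (2 * pi * y)"
        unfolding arg by (rule sin_2pi_minus)
      then show ?thesis
        by (simp add: G_def prod_eq_iff algebra_simps)
    qed
    show "G v \<notin> \<int> \<times> \<int>" for v
    proof
      assume G: "G v \<in> \<int> \<times> \<int>"
      have "\<exists>i. (1 - 2 * snd v) *\<^sub>R b + sin (2 * pi * snd v) *\<^sub>R w = of_int i *\<^sub>R b"
      proof (cases "b = 0")
        case True
        then show ?thesis by (simp add: w_def zero_prod_def)
      next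
        case False
        then have N: "N \<noteq> 0"
          by (auto simp: N_def prod_eq_iff sum_power2_eq_zero_iff)
        have "fst b * snd (2 *\<^sub>R G v - a) - snd b * fst (2 *\<^sub>R G v - a)
            = 2 * sin (2 * pi * snd v) * (N / (4 * N))"
          unfolding G_def w_def N_def power2_eq_square
          by (simp add: algebra_simps add_divide_distrib)
        also have "\<dots> = sin (2 * pi * snd v) / 2"
          using N by simp
        finally have "sin (2 * pi * snd v) / 2
            = fst b * snd (2 *\<^sub>R G v - a) - snd b * fst (2 *\<^sub>R G v - a)" ..
        moreover have "\<dots> \<in> \<int>"
          using G a b by (auto simp: mem_Times_iff intro!: Ints_diff Ints_mult)
        ultimately have "sin (2 * pi * snd v) / 2 \<in> \<int>"
          by (rule ssubst)
        then have "sin (2 * pi * snd v) = 0"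
          using Ints_nonzero_abs_ge1[of "sin (2 * pi * snd v) / 2"] abs_sin_le_one[of "2 * pi * snd v"]
          by auto
        then obtain i :: int where "2 * pi * snd v = of_int i * pi"
          unfolding sin_zero_iff_int2 by blast
        then have "2 * snd v = of_int i"
          using pi_neq_zero by (simp add: field_simps)
        then show ?thesis
          using \<open>sin (2 * pi * snd v) = 0\<close> by (intro exI[of _ "1 - i"]) simp
      qed
      then obtain i :: int where "G v = a /\<^sub>R 2 + of_int i *\<^sub>R b"
        by (auto simp: G_def add.assoc)
      then have "a /\<^sub>R 2 = G v - of_int i *\<^sub>R b"
        by simp
      then have "a /\<^sub>R 2 \<in> \<int> \<times> \<int>"
        using G b by (auto simp: mem_Times_iff)
      then show False
        using False by simp
    qed
  qed
qed

section \<open>Lifting maps from the torus to the plane\<close>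

lemma lattice_valued_constant:
  fixes f :: "'a::topological_space \<Rightarrow> real \<times> real"
  assumes "connected S" "continuous_on S f" "\<And>x. x \<in> S \<Longrightarrow> f x \<in> \<int> \<times> \<int>" "x \<in> S" "y \<in> S"
  shows "f x = f y"
proof -
  have "fst (f x) = fst (f y)" "snd (f x) = snd (f y)"
    using assms
    by (auto intro!: continuous_integer_valued_constant[of S "\<lambda>x. fst (f x)"]
        continuous_integer_valued_constant[of S "\<lambda>x. snd (f x)"] continuous_intros simp: mem_Times_iff)
  then show ?thesis
    by (simp add: prod_eq_iff)
qed

lemma to_torus_eq_iff_lattice: "to_torus p = to_torus q \<longleftrightarrow> p - q \<in> \<int> \<times> \<int>"
  by (simp add: to_torus_eq_iff mem_Times_iff)

text \<open>
  Uniqueness of lifts: two lifts of one map differ by a continuous function with values in a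
  discrete set.
\<close>

lemma lift_difference_constant:
  fixes K K' :: "'a::topological_space \<Rightarrow> real \<times> real"
  assumes "connected S" "continuous_on S K" "continuous_on S K'"
    and "\<And>s. s \<in> S \<Longrightarrow> to_torus (K s) = to_torus (K' s)" and "s \<in> S" "t \<in> S"
  shows "K s - K' s = K t - K' t"
  using assms
  by (intro lattice_valued_constant[of S "\<lambda>s. K s - K' s"] continuous_intros)
    (auto simp flip: to_torus_eq_iff_lattice)

lemma exp_turn_eq_iff:
  "exp (of_real (2 * pi * r) * \<i>) = exp (of_real (2 * pi * t) * \<i>) \<longleftrightarrow> r - t \<in> \<int>"
proof -
  have "of_real (2 * pi * r) * \<i> = of_real (2 * pi * t) * \<i> + of_int (2 * n) * of_real pi * \<i>
      \<longleftrightarrow> r - t = of_int n" for n :: int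
  proof -
    have "of_real (2 * pi * t) * \<i> + of_int (2 * n) * of_real pi * \<i>
        = of_real (2 * pi * (t + of_int n)) * \<i>"
      by (simp add: algebra_simps)
    moreover have "complex_of_real (2 * pi * r) * \<i> = of_real (2 * pi * (t + of_int n)) * \<i>
        \<longleftrightarrow> r = t + of_int n"
      unfolding mult_cancel_right of_real_eq_iff by simp
    ultimately show ?thesis
      by auto
  qed
  then show ?thesis
    by (auto simp: exp_eq elim: Ints_cases)
qed

text \<open>
  The two circle-valued coordinates embed the torus in \<open>\<complex>\<^sup>2\<close>. They replace the covering
  \<open>\<real>\<^sup>2 \<rightarrow> \<real>\<^sup>2/\<int>\<^sup>2\<close> by the exponential covering, for which continuous logarithms provide lifts.
\<close>

lift_definition torus_coord1 :: "torus \<Rightarrow> complex" is "\<lambda>p. exp (of_real (2 * pi * fst p) * \<i>)"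
  by (simp add: lattice_rel_def exp_turn_eq_iff del: of_real_mult)

lift_definition torus_coord2 :: "torus \<Rightarrow> complex" is "\<lambda>p. exp (of_real (2 * pi * snd p) * \<i>)"
  by (simp add: lattice_rel_def exp_turn_eq_iff del: of_real_mult)

lemma to_torus_surj: "\<exists>p. t = to_torus p"
  by (induction t rule: torus.abs_induct) auto

lemma torus_map_lift:
  fixes k :: "'a::real_normed_vector \<Rightarrow> torus"
  assumes k: "continuous_on S k" and S: "contractible S"
  obtains K where "continuous_on S K" "\<And>s. s \<in> S \<Longrightarrow> to_torus (K s) = k s"
proof -
  have coord: "\<exists>g. continuous_on S g \<and> (\<forall>s\<in>S. \<forall>p. k s = to_torus p \<longrightarrow> sel p - g s \<in> \<int>)"
    if c: "\<And>p. c (to_torus p) = exp (of_real (2 * pi * sel p) * \<i>)" and sel: "continuous_on UNIV sel"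
    for c :: "torus \<Rightarrow> complex" and sel :: "real \<times> real \<Rightarrow> real"
  proof -
    have "continuous_on UNIV c"
      by (intro continuous_on_torusI, unfold c) (intro continuous_intros sel)
    then have cont: "continuous_on S (\<lambda>s. c (k s))"
      by (rule continuous_on_compose2[OF _ k]) auto
    have "c (k s) \<noteq> 0" for s
      by (induction "k s" rule: torus.abs_induct) (metis c exp_not_eq_zero)
    then obtain g where g: "continuous_on S g" "\<And>s. s \<in> S \<Longrightarrow> c (k s) = exp (g s)"
      using continuous_logarithm_on_contractible[OF cont S] by blast
    have "sel p - Im (g s) / (2 * pi) \<in> \<int>" if "s \<in> S" "k s = to_torus p" for s p
    proof -
      have "exp (of_real (2 * pi * sel p) * \<i>) = exp (g s)"
        using g(2)[OF that(1)] that(2) c by simp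
      then obtain n :: int where "of_real (2 * pi * sel p) * \<i> = g s + of_int (2 * n) * of_real pi * \<i>"
        by (auto simp: exp_eq)
      then have "Im (of_real (2 * pi * sel p) * \<i>) = Im (g s + of_int (2 * n) * of_real pi * \<i>)"
        by simp
      then have "sel p - Im (g s) / (2 * pi) = of_int n"
        by (simp add: field_simps)
      then show ?thesis by simp
    qed
    then show ?thesis
      using g(1) by (intro exI[of _ "\<lambda>s. Im (g s) / (2 * pi)"]) (auto intro!: continuous_intros)
  qed
  obtain g1 where g1: "continuous_on S g1" "\<forall>s\<in>S. \<forall>p. k s = to_torus p \<longrightarrow> fst p - g1 s \<in> \<int>"
    using coord[OF torus_coord1.abs_eq continuous_on_fst[OF continuous_on_id]] by blast
  obtain g2 where g2: "continuous_on S g2" "\<forall>s\<in>S. \<forall>p. k s = to_torus p \<longrightarrow> snd p - g2 s \<in> \<int>"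
    using coord[OF torus_coord2.abs_eq continuous_on_snd[OF continuous_on_id]] by blast
  show thesis
  proof
    show "continuous_on S (\<lambda>s. (g1 s, g2 s))"
      using g1(1) g2(1) by (intro continuous_intros)
    fix s assume s: "s \<in> S"
    obtain p where p: "k s = to_torus p"
      using to_torus_surj by blast
    then have "fst p - g1 s \<in> \<int>" "snd p - g2 s \<in> \<int>"
      using g1(2) g2(2) s by blast+
    then have "to_torus p = to_torus (g1 s, g2 s)"
      by (simp add: to_torus_eq_iff)
    then show "to_torus (g1 s, g2 s) = k s"
      using p by simp
  qed
qed

text \<open>
  Lift the homotopy to the square. Its lower and upper edges are translates of \<open>P\<close> and \<open>Q\<close>, and its
  two other edges, along which the end points stay fixed in the torus, are constant.
\<close>

lemma displacement_homotopy_invariant: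
  fixes P Q :: "real \<Rightarrow> real \<times> real"
  assumes P: "path P" and Q: "path Q" and hom: "homotopic_paths UNIV (to_torus \<circ> P) (to_torus \<circ> Q)"
  shows "P 1 - P 0 = Q 1 - Q 0"
proof -
  obtain h :: "real \<times> real \<Rightarrow> torus" where h: "continuous_on ({0..1} \<times> {0..1}) h"
    and bottom: "\<forall>t\<in>{0..1}. h (0, t) = (to_torus \<circ> P) t"
    and top: "\<forall>t\<in>{0..1}. h (1, t) = (to_torus \<circ> Q) t"
    and sides: "\<forall>s\<in>{0..1}. pathstart (h \<circ> Pair s) = pathstart (to_torus \<circ> P) \<and>
      pathfinish (h \<circ> Pair s) = pathfinish (to_torus \<circ> P)"
    using hom unfolding homotopic_paths by blast
  have "convex ({0..1::real} \<times> {0..1::real})"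
    by (intro convex_Times) auto
  then obtain K where K: "continuous_on ({0..1} \<times> {0..1}) K"
    "\<And>v. v \<in> {0..1} \<times> {0..1} \<Longrightarrow> to_torus (K v) = h v"
    using torus_map_lift[OF h] convex_imp_contractible by blast
  have edge: "continuous_on {0..1} (\<lambda>t. K (s, t))" "continuous_on {0..1} (\<lambda>t. K (t, s))"
    if "s \<in> {0..1}" for s
    using that by (auto intro!: continuous_on_compose2[OF K(1)] continuous_intros)
  have P_edge: "K (0, 1) - P 1 = K (0, 0) - P 0"
    using P K(2) bottom edge(1)[of 0]
    by (intro lift_difference_constant[of "{0..1}" "\<lambda>t. K (0, t)" P]) (auto simp: path_def)
  have Q_edge: "K (1, 1) - Q 1 = K (1, 0) - Q 0"
    using Q K(2) top edge(1)[of 1]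
    by (intro lift_difference_constant[of "{0..1}" "\<lambda>t. K (1, t)" Q]) (auto simp: path_def)
  have left: "K (1, 0) - P 0 = K (0, 0) - P 0"
    using K(2) sides edge(2)[of 0]
    by (intro lift_difference_constant[of "{0..1}" "\<lambda>s. K (s, 0)" "\<lambda>_. P 0"]) (auto simp: pathstart_def pathfinish_def)
  have right: "K (1, 1) - P 1 = K (0, 1) - P 1"
    using K(2) sides edge(2)[of 1]
    by (intro lift_difference_constant[of "{0..1}" "\<lambda>s. K (s, 1)" "\<lambda>_. P 1"]) (auto simp: pathstart_def pathfinish_def)
  have "P 1 - P 0 = K (0, 1) - K (0, 0)"
    using P_edge by (simp add: algebra_simps)
  also have "\<dots> = K (1, 1) - K (1, 0)"
    using left right by simp
  also have "\<dots> = Q 1 - Q 0"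
    using Q_edge by (simp add: algebra_simps)
  finally show ?thesis .
qed

section \<open>Straight loops and the matrix of a homotopy class\<close>

definition line :: "real \<times> real \<Rightarrow> real \<Rightarrow> torus" where
  "line w t = to_torus (t *\<^sub>R w)"

lemma line_in_loops_at_base:
  assumes "w \<in> \<int> \<times> \<int>"
  shows "line w \<in> loops_at base"
proof -
  have "path (line w)"
    unfolding path_def line_def
    by (intro continuous_on_compose2[OF continuous_on_to_torus] continuous_intros) auto
  then show ?thesis
    using assms
    by (simp add: loops_at_def base_def line_def pathstart_def pathfinish_def to_torus_eq_iff_lattice
        zero_prod_def[symmetric])
qed

lemma line_join_homotopic:
  assumes v: "v \<in> \<int> \<times> \<int>"
  shows "homotopic_paths UNIV (line v +++ line w) (line (v + w))"
proof -
  have "homotopic_paths UNIV (linepath 0 v +++ linepath v (v + w)) (linepath 0 (v + w))"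
    using convex_imp_simply_connected[of "UNIV :: (real \<times> real) set"]
    by (auto simp: simply_connected_eq_homotopic_paths)
  then have "homotopic_paths UNIV (to_torus \<circ> (linepath 0 v +++ linepath v (v + w)))
      (to_torus \<circ> linepath 0 (v + w))"
    by (rule homotopic_paths_continuous_image) (auto intro: continuous_on_to_torus)
  moreover have "to_torus \<circ> linepath 0 (v + w) = line (v + w)"
    by (auto simp: line_def linepath_def)
  moreover have "to_torus \<circ> (linepath 0 v +++ linepath v (v + w)) = line v +++ line w"
    using v by (auto simp: line_def linepath_def joinpaths_def to_torus_eq_iff_lattice algebra_simps)
  ultimately show ?thesis
    by simp
qed

interpretation torus_pi1: group torus_pi1
  unfolding torus_pi1_def by (rule group_fundamental_group)

lemma path_class_line_carrier:
  assumes "w \<in> \<int> \<times> \<int>"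
  shows "path_class (line w) \<in> carrier torus_pi1"
  using line_in_loops_at_base[OF assms] by (simp add: torus_pi1_def carrier_fundamental_group)

lemma path_class_line_mult:
  assumes "v \<in> \<int> \<times> \<int>" "w \<in> \<int> \<times> \<int>"
  shows "path_class (line v) \<otimes>\<^bsub>torus_pi1\<^esub> path_class (line w) = path_class (line (v + w))"
proof -
  have "path_class (line v +++ line w) = path_class (line (v + w))"
    using assms line_join_homotopic line_in_loops_at_base
    by (subst path_class_eq_iff) (auto simp: loops_at_def)
  then show ?thesis
    using assms line_in_loops_at_base by (simp add: torus_pi1_def mult_fundamental_group)
qed

lemma path_class_line_zero: "path_class (line 0) = \<one>\<^bsub>torus_pi1\<^esub>"
proof -
  have "line 0 = (\<lambda>_. base)"
    by (simp add: line_def base_def zero_prod_def fun_eq_iff)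
  then show ?thesis
    by (simp add: torus_pi1_def fundamental_group_def)
qed

text \<open>
  By \<open>path_class_line_mult\<close>, \<open>n \<mapsto> line(nw)\<close> is a homomorphism from the integers, and it agrees with
  the powers of \<open>line w\<close> at 1.
\<close>

lemma path_class_line_pow:
  assumes w: "w \<in> \<int> \<times> \<int>"
  shows "path_class (line w) [^]\<^bsub>torus_pi1\<^esub> (n::int) = path_class (line (of_int n *\<^sub>R w))"
proof -
  let ?c = "\<lambda>n::int. path_class (line (of_int n *\<^sub>R w))"
  have lat: "of_int n *\<^sub>R w \<in> \<int> \<times> \<int>" for n
    using w by (auto simp: mem_Times_iff)
  have add: "?c m \<otimes>\<^bsub>torus_pi1\<^esub> ?c n = ?c (m + n)" for m n
    by (simp add: path_class_line_mult lat scaleR_add_left)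
  have carr: "?c n \<in> carrier torus_pi1" for n
    by (rule path_class_line_carrier[OF lat])
  have nat: "path_class (line w) [^]\<^bsub>torus_pi1\<^esub> k = ?c (int k)" for k :: nat
  proof (induction k)
    case (Suc k)
    then show ?case
      using add[of "int k" 1] by (simp add: add.commute)
  qed (simp add: path_class_line_zero)
  have inv_c: "inv\<^bsub>torus_pi1\<^esub> (?c m) = ?c (- m)" for m
    using add[of "- m" m] carr[of m] carr[of "- m"]
    by (intro torus_pi1.inv_equality) (simp_all add: path_class_line_zero)
  show ?thesis
    using inv_c[of "- n"] by (simp add: int_pow_def2 nat)
qed

text \<open>
  The coordinates are swapped because the first generator of the fundamental group runs in the
  direction of the second coordinate of the plane.
\<close>

lemma pi1_of_eq: "pi1_of (m, n) = path_class (line (of_int n, of_int m))"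
proof -
  have "(\<lambda>t. to_torus (0, t)) = line (0, 1)" "(\<lambda>t. to_torus (t, 0)) = line (1, 0)"
    by (simp_all add: line_def fun_eq_iff)
  then show ?thesis
    by (simp add: pi1_of_def path_class_line_pow path_class_line_mult)
qed

text \<open>
  The matrix of a homotopy class is read off from any lift \<open>F\<close> of any of its members \<open>f\<close>. Join \<open>f(base)\<close>
  to the base point by the image of the segment from \<open>0\<close> to \<open>F 0\<close>. Then the loop that represents
  the image of a straight loop lifts to a path \<open>R\<close> which follows this segment, the \<open>F\<close>-image of a
  straight segment, and a translate of the first segment backwards. So its displacement is the
  difference of the two values of \<open>F\<close>, and by homotopy invariance it equals that of the straight
  loop given by the matrix.
\<close>

lemma induced_hom_displacement:
  assumes f: "f \<in> \<beta>" "continuous_on UNIV f"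
    and F: "continuous_on UNIV F" "\<And>v. to_torus (F v) = f (to_torus v)"
    and hom: "induced_hom base \<beta> (pi1_of (m, n)) = pi1_of (m', n')"
  shows "F (v + (of_int n, of_int m)) = F v + (of_int n', of_int m')"
proof -
  let ?w = "(of_int n, of_int m) :: real \<times> real"
  let ?w' = "(of_int n', of_int m') :: real \<times> real"
  define P where "P = linepath 0 ?w"
  define g where "g = linepath 0 (F 0)"
  have line: "to_torus \<circ> P = line ?w" "to_torus \<circ> linepath 0 ?w' = line ?w'"
    by (simp_all add: P_def line_def linepath_def fun_eq_iff)
  have w: "?w \<in> \<int> \<times> \<int>"
    by simp
  have torus0: "to_torus 0 = base"
    by (simp add: base_def zero_prod_def)
  have pF: "path (F \<circ> P)"
    unfolding P_def by (intro path_continuous_image continuous_on_subset[OF F(1)]) auto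
  define R where "R = g +++ (F \<circ> P) +++ (\<lambda>t. reversepath g t + (F ?w - F 0))"
  have rev: "path (\<lambda>t. reversepath g t + (F ?w - F 0))"
    unfolding path_def g_def reversepath_def linepath_def by (intro continuous_intros)
  have "path g"
    by (simp add: g_def)
  then have pR: "path R"
    unfolding R_def using pF rev
    by (simp add: g_def P_def pathstart_compose pathfinish_compose) (simp add: pathstart_def linepath_def)
  have "to_torus ?w = to_torus 0"
    unfolding to_torus_eq_iff_lattice by simp
  then have Fw: "F ?w - F 0 \<in> \<int> \<times> \<int>"
    unfolding to_torus_eq_iff_lattice[symmetric] F(2) by simp
  define \<gamma> where "\<gamma> = to_torus \<circ> g"
  have R: "to_torus \<circ> R = \<gamma> +++ (f \<circ> line ?w) +++ reversepath \<gamma>"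
    using Fw F(2) by (auto simp: R_def \<gamma>_def fun_eq_iff joinpaths_def reversepath_def to_torus_eq_iff_lattice
        line(1)[symmetric])
  have "path \<gamma>"
    unfolding \<gamma>_def g_def
    by (intro path_continuous_image continuous_on_subset[OF continuous_on_to_torus]) auto
  moreover have "pathstart \<gamma> = base" "pathfinish \<gamma> = f (pathstart (line ?w))"
    by (simp_all add: \<gamma>_def g_def pathstart_compose pathfinish_compose torus0 F(2))
      (simp add: pathstart_def line_def base_def)
  moreover have "path (to_torus \<circ> R)"
    using pR by (intro path_continuous_image continuous_on_subset[OF continuous_on_to_torus]) auto
  moreover have "line ?w \<in> pi1_of (m, n)"
    using line_in_loops_at_base[OF w] by (simp add: pi1_of_eq path_class_def loops_at_def)
  ultimately have "to_torus \<circ> R \<in> induced_hom base \<beta> (pi1_of (m, n))"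
    using f(1) unfolding induced_hom_def R by force
  then have "to_torus \<circ> R \<in> path_class (line ?w')"
    unfolding hom by (simp only: pi1_of_eq)
  then have "homotopic_paths UNIV (to_torus \<circ> linepath 0 ?w') (to_torus \<circ> R)"
    unfolding line path_class_def by simp
  then have "linepath 0 ?w' 1 - linepath 0 ?w' 0 = R 1 - R 0"
    by (rule displacement_homotopy_invariant[OF path_linepath pR])
  then have "F ?w - F 0 = ?w'"
    by (simp add: R_def g_def joinpaths_def reversepath_def linepath_def)
  moreover have "F (v + ?w) - F v = F (0 + ?w) - F 0"
    by (rule lift_difference_constant[of UNIV "\<lambda>v. F (v + ?w)" F])
      (auto intro!: continuous_on_compose2[OF F(1)] F(1) continuous_intros
        simp: F(2) intro!: arg_cong[of _ _ f] simp: to_torus_eq_iff_lattice)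
  ultimately show ?thesis
    by (simp add: algebra_simps)
qed

section \<open>Homotopies of maps of the torus\<close>

lemma open_to_torus_image:
  assumes "open U"
  shows "open (to_torus ` U)"
proof -
  have "to_torus -` to_torus ` U = (\<Union>w\<in>\<int> \<times> \<int>. (+) w ` U)"
  proof (rule equalityI; rule subsetI)
    fix p assume "p \<in> to_torus -` to_torus ` U"
    then have "to_torus p \<in> to_torus ` U"
      by (rule vimageD)
    then obtain q where q: "to_torus p = to_torus q" "q \<in> U"
      by (rule imageE)
    have "p = (p - q) + q"
      by simp
    then have "p \<in> (+) (p - q) ` U"
      by (rule image_eqI[OF _ q(2)])
    then show "p \<in> (\<Union>w\<in>\<int> \<times> \<int>. (+) w ` U)"
      by (rule UN_I[OF q(1)[unfolded to_torus_eq_iff_lattice]])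
  next
    fix p assume "p \<in> (\<Union>w\<in>\<int> \<times> \<int>. (+) w ` U)"
    then obtain w where w: "w \<in> \<int> \<times> \<int>" "p \<in> (+) w ` U"
      by (rule UN_E)
    from w(2) obtain q where q: "p = w + q" "q \<in> U"
      by (rule imageE)
    have "to_torus p = to_torus q"
      using w(1) q(1) unfolding to_torus_eq_iff_lattice by simp
    then show "p \<in> to_torus -` to_torus ` U"
      by (rule vimageI[OF _ imageI[OF q(2)]])
  qed
  moreover have "open (\<Union>w\<in>\<int> \<times> \<int>. (+) w ` U)"
    by (intro open_UN ballI open_translation assms)
  ultimately show ?thesis
    by (simp only: open_torus_def)
qed

text \<open>
  The product of a quotient map with an identity need not be a quotient map; here it is one because
  the projection of the plane to the torus is open.
\<close>

lemma continuous_on_times_torusI: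
  fixes k :: "real \<times> torus \<Rightarrow> 'a::topological_space"
  assumes "continuous_on UNIV (\<lambda>(t, p). k (t, to_torus p))"
  shows "continuous_on UNIV k"
proof -
  have "open (k -` V)" if "open V" for V
  proof (rule open_prod_intro)
    fix z assume z: "z \<in> k -` V"
    obtain t p where tp: "z = (t, to_torus p)"
      using to_torus_surj by (metis surj_pair)
    let ?U = "(\<lambda>(t, p). k (t, to_torus p)) -` V"
    have "open ?U"
      using assms that by (simp add: continuous_on_open_vimage)
    moreover have "(t, p) \<in> ?U"
      using z tp by simp
    ultimately obtain A B where AB: "open A" "open B" "(t, p) \<in> A \<times> B" "A \<times> B \<subseteq> ?U"
      by (rule open_prod_elim)
    then have "z \<in> A \<times> to_torus ` B" "A \<times> to_torus ` B \<subseteq> k -` V"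
      using tp by auto
    then show "\<exists>A B. open A \<and> open B \<and> z \<in> A \<times> B \<and> A \<times> B \<subseteq> k -` V"
      using AB(1,2) open_to_torus_image by blast
  qed
  then show ?thesis
    by (simp add: continuous_on_open_vimage)
qed

lemma to_torus_add_periodic:
  assumes F: "\<And>v. to_torus (F v) = f (to_torus v)"
    and D: "\<And>v w. w \<in> \<int> \<times> \<int> \<Longrightarrow> D (v + w) = D v"
    and uv: "to_torus u = to_torus v"
  shows "to_torus (F u + D u) = to_torus (F v + D v)"
proof -
  have "D (v + (u - v)) = D v"
    using uv by (intro D) (simp add: to_torus_eq_iff_lattice)
  then have "D u = D v"
    by simp
  moreover have "to_torus (F u) = to_torus (F v)"
    using uv by (simp add: F)
  ultimately show ?thesis
    by (simp add: to_torus_eq_iff_lattice)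
qed

text \<open>
  The straight-line homotopy from \<open>F\<close> to \<open>F + D\<close> descends to the torus.
\<close>

lemma homotopic_if_lifts_differ_periodically:
  assumes F: "continuous_on UNIV F" "\<And>v. to_torus (F v) = f (to_torus v)"
    and D: "continuous_on UNIV D" "\<And>v w. w \<in> \<int> \<times> \<int> \<Longrightarrow> D (v + w) = D v"
    and g: "\<And>v. to_torus (F v + D v) = g (to_torus v)"
  shows "homotopic_with_canon (\<lambda>_. True) UNIV UNIV f g"
proof -
  define k where "k = (\<lambda>(t::real, x). to_torus (F (rep_torus x) + t *\<^sub>R D (rep_torus x)))"
  have k: "k (t, to_torus v) = to_torus (F v + t *\<^sub>R D v)" for t v
    unfolding k_def prod.case
    by (rule to_torus_add_periodic[of F f "\<lambda>v. t *\<^sub>R D v"])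
      (simp_all add: F(2) D(2) Quotient3_abs_rep[OF Quotient3_torus])
  have "continuous_on UNIV k"
  proof (rule continuous_on_times_torusI)
    show "continuous_on UNIV (\<lambda>(t, p). k (t, to_torus p))"
      unfolding k case_prod_unfold
      by (intro continuous_on_compose2[OF continuous_on_to_torus] continuous_intros
          continuous_on_compose2[OF F(1)] continuous_on_compose2[OF D(1)]) auto
  qed
  then have "continuous_on ({0..1} \<times> UNIV) k"
    by (rule continuous_on_subset) simp
  moreover have "k (0, x) = f x" "k (1, x) = g x" for x
    using to_torus_surj[of x] by (auto simp: k F(2) g)
  moreover have "continuous_map (prod_topology (top_of_set {0..1}) (top_of_set UNIV)) (top_of_set UNIV) k
      \<longleftrightarrow> continuous_on ({0..1} \<times> UNIV) k"
    unfolding prod_topology_subtopology_eu continuous_map_subtopology_eu by simp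
  ultimately show ?thesis
    unfolding homotopic_with_def by blast
qed

lemma coordinate_shift_invariant_imp_lattice_invariant:
  fixes D :: "real \<times> real \<Rightarrow> 'a"
  assumes x: "\<And>v. D (v + (1, 0)) = D v" and y: "\<And>v. D (v + (0, 1)) = D v" and w: "w \<in> \<int> \<times> \<int>"
  shows "D (v + w) = D v"
proof -
  have step: "D (v + of_int n *\<^sub>R e) = D v" if e: "\<And>v. D (v + e) = D v" for e v and n :: int
  proof (induction n rule: int_induct[where k = 0])
    case (step1 i)
    then show ?case
      using e[of "v + of_int i *\<^sub>R e"] by (simp add: scaleR_left_distrib add.assoc)
  next
    case (step2 i)
    then show ?case
      using e[of "v + of_int (i - 1) *\<^sub>R e"] by (simp add: scaleR_left_diff_distrib)
  qed simp
  obtain m n :: int where "w = of_int m *\<^sub>R (1, 0) + of_int n *\<^sub>R (0, 1)"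
    using w by (auto elim!: Ints_cases)
  then show ?thesis
    using step[OF y, of "v + of_int m *\<^sub>R (1, 0)" n] step[OF x, of v m] by (simp add: add.assoc)
qed

section \<open>Coincidences under the involution\<close>

text \<open>
  A lift of \<open>tau2\<close> to the plane.
\<close>

definition glide :: "real \<times> real \<Rightarrow> real \<times> real" where
  "glide v = (fst v + 1/2, 1 - snd v)"

lemma tau2_to_torus: "tau2 (to_torus v) = to_torus (glide v)"
  by (simp add: tau2.abs_eq glide_def case_prod_unfold)

lemma continuous_on_glide: "continuous_on UNIV glide"
  unfolding glide_def by (intro continuous_intros)

lemma coincidence_iff_lattice:
  assumes "\<And>v. to_torus (F v) = f (to_torus v)"
  shows "f (tau2 (to_torus v)) = f (to_torus v) \<longleftrightarrow> F (glide v) - F v \<in> \<int> \<times> \<int>"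
  by (simp add: tau2_to_torus assms[symmetric] to_torus_eq_iff_lattice)

lemma glide_difference_equivariance:
  fixes F :: "real \<times> real \<Rightarrow> real \<times> real"
  assumes a: "\<And>v. F (v + (1, 0)) = F v + a" and b: "\<And>v. F (v + (0, 1)) = F v + b"
  defines "G \<equiv> \<lambda>v. F (glide v) - F v"
  shows "G (v + (1, 0)) = G v" "G (v + (0, 1)) = G v - 2 *\<^sub>R b" "G (glide v) = a - G v"
proof -
  have "glide (v + (1, 0)) = glide v + (1, 0)"
    by (simp add: glide_def prod_eq_iff)
  then show "G (v + (1, 0)) = G v"
    by (simp add: G_def a)
  have "F (glide v) = F (glide (v + (0, 1))) + b"
    using b[of "glide (v + (0, 1))"] by (simp add: glide_def algebra_simps)
  then show "G (v + (0, 1)) = G v - 2 *\<^sub>R b"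
    by (simp add: G_def b scaleR_2)
  have "glide (glide v) = v + (1, 0)"
    by (simp add: glide_def prod_eq_iff)
  then show "G (glide v) = a - G v"
    by (simp add: G_def a)
qed

text \<open>
  After moving the centre of symmetry \<open>a/2\<close> to the origin, the difference becomes an odd map, and
  \<open>odd_quasiperiodic_map_hits_multiple\<close> makes it take a value in \<open>2\<nat>b\<close>. As \<open>a/2\<close> is a lattice
  point, so is the corresponding value of the difference.
\<close>

lemma glide_difference_hits_lattice:
  fixes F :: "real \<times> real \<Rightarrow> real \<times> real"
  assumes F: "continuous_on UNIV F"
    and a: "\<And>v. F (v + (1, 0)) = F v + a" and b: "\<And>v. F (v + (0, 1)) = F v + b"
    and lat: "a /\<^sub>R 2 \<in> \<int> \<times> \<int>" "b \<in> \<int> \<times> \<int>" and nz: "b \<noteq> 0"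
  obtains v where "F (glide v) - F v \<in> \<int> \<times> \<int>"
proof -
  define G where "G v = F (glide v) - F v" for v
  note G = glide_difference_equivariance[of F, OF a b, folded G_def]
  define c where "c p = Complex (fst p) (snd p)" for p :: "real \<times> real"
  have c: "c (p + q) = c p + c q" "c (p - q) = c p - c q" "c (r *\<^sub>R p) = r *\<^sub>R c p" "c (- p) = - c p"
    "c p = c q \<longleftrightarrow> p = q" for p q r
    by (simp_all add: c_def complex_eq_iff prod_eq_iff)
  define H where "H v = c (G v - a /\<^sub>R 2)" for v
  have "continuous_on UNIV H"
    unfolding H_def c_def G_def
    by (intro continuous_intros F continuous_on_compose2[OF F continuous_on_glide]) auto
  moreover have "c b \<noteq> 0"
    using nz c(5)[of b 0] by (simp add: c_def zero_complex.code)
  moreover have "H (x + 1, y) = H (x, y)" for x y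
    using G(1)[of "(x, y)"] by (simp add: H_def)
  moreover have "H (x, y + 1) = H (x, y) - 2 * c b" for x y
    using G(2)[of "(x, y)"] by (simp add: H_def c scaleR_conv_of_real)
  moreover have "H (x + 1/2, 1 - y) = - H (x, y)" for x y
  proof -
    have "G (x + 1/2, 1 - y) - a /\<^sub>R 2 = - (G (x, y) - a /\<^sub>R 2)"
      using G(3)[of "(x, y)"] by (simp add: glide_def prod_eq_iff)
    then show ?thesis
      by (simp add: H_def c)
  qed
  ultimately obtain v and k :: nat where "H v = 2 * of_nat k * c b"
    by (rule odd_quasiperiodic_map_hits_multiple)
  then have "c (G v - a /\<^sub>R 2) = c ((2 * of_nat k) *\<^sub>R b)"
    by (simp add: H_def c(3) scaleR_conv_of_real)
  then have "G v = a /\<^sub>R 2 + (2 * of_nat k) *\<^sub>R b"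
    unfolding c(5) by (simp add: algebra_simps)
  then have "G v \<in> \<int> \<times> \<int>"
    using lat by (auto simp: mem_Times_iff)
  then show thesis
    using that by (simp add: G_def)
qed

text \<open>
  Every map \<open>G\<close> with the symmetries of the difference \<open>G\<^sub>0\<close> of \<open>F\<close> is the difference of some \<open>F + D\<close>
  with \<open>D\<close> periodic: since \<open>G\<^sub>0 - G\<close> is periodic and changes sign under the glide reflection,
  \<open>D = (G\<^sub>0 - G)/2\<close> does it. It remains to take for \<open>G\<close> a map that avoids the lattice.
\<close>

lemma coincidence_free_homotopic_map:
  assumes F: "continuous_on UNIV F" "\<And>v. to_torus (F v) = f (to_torus v)"
    and a: "\<And>v. F (v + (1, 0)) = F v + a" and b: "\<And>v. F (v + (0, 1)) = F v + b"
    and lat: "a \<in> \<int> \<times> \<int>" "b \<in> \<int> \<times> \<int>" and ab: "b = 0 \<or> a /\<^sub>R 2 \<notin> \<int> \<times> \<int>"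
  obtains g where "homotopic_with_canon (\<lambda>_. True) UNIV UNIV f g" "\<And>x. g (tau2 x) \<noteq> g x"
proof -
  define G0 where "G0 v = F (glide v) - F v" for v
  note G0 = glide_difference_equivariance[of F, OF a b, folded G0_def]
  obtain G :: "real \<times> real \<Rightarrow> real \<times> real" where G: "continuous_on UNIV G" "\<And>x y. G (x + 1, y) = G (x, y)"
    "\<And>x y. G (x, y + 1) = G (x, y) - 2 *\<^sub>R b" "\<And>x y. G (x + 1/2, 1 - y) = a - G (x, y)"
    "\<And>v. G v \<notin> \<int> \<times> \<int>"
    using equivariant_map_avoiding_lattice[OF lat ab] by metis
  define D where "D v = (G0 v - G v) /\<^sub>R 2" for v
  have "D (v + (1, 0)) = D v" for v
    using G(2)[of "fst v" "snd v"] G0(1)[of v] by (simp add: D_def plus_prod_def)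
  moreover have "D (v + (0, 1)) = D v" for v
    using G(3)[of "fst v" "snd v"] G0(2)[of v] by (simp add: D_def plus_prod_def)
  ultimately have per: "D (v + w) = D v" if "w \<in> \<int> \<times> \<int>" for v w
    using that by (rule coordinate_shift_invariant_imp_lattice_invariant)
  have D: "continuous_on UNIV D"
    unfolding D_def G0_def
    by (intro continuous_intros F(1) G(1) continuous_on_compose2[OF F(1) continuous_on_glide]) auto
  define g where "g x = to_torus (F (rep_torus x) + D (rep_torus x))" for x
  have g: "to_torus (F v + D v) = g (to_torus v)" for v
    unfolding g_def
    by (rule to_torus_add_periodic[of F f D, symmetric])
      (simp_all add: F(2) per Quotient3_abs_rep[OF Quotient3_torus])
  have "F (glide v) + D (glide v) - (F v + D v) = G v" for v
  proof -
    have "D (glide v) = - D v"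
      using G0(3)[of v] G(4)[of "fst v" "snd v"] by (simp add: D_def glide_def prod_eq_iff field_simps)
    then have "F (glide v) + D (glide v) - (F v + D v) = G0 v - 2 *\<^sub>R D v"
      by (simp add: G0_def scaleR_2)
    then show ?thesis
      by (simp add: D_def)
  qed
  then have "g (tau2 (to_torus v)) \<noteq> g (to_torus v)" for v
    using coincidence_iff_lattice[of "\<lambda>v. F v + D v" g v, OF g] G(5) by simp
  then have "g (tau2 x) \<noteq> g x" for x
    using to_torus_surj[of x] by blast
  with homotopic_if_lifts_differ_periodically[OF F D per g] show thesis
    by (rule that)
qed

lemma half_int_in_Ints_iff: "real_of_int n / 2 \<in> \<int> \<longleftrightarrow> even n"
proof
  assume "real_of_int n / 2 \<in> \<int>"
  then obtain k where "real_of_int n / 2 = of_int k"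
    by (rule Ints_cases)
  then have "n = 2 * k"
    by linarith
  then show "even n"
    by simp
qed (auto elim!: evenE)

theorem theorem2:
  fixes \<beta> :: "(torus \<Rightarrow> torus) set" and A :: "int^2^2"
  assumes "\<beta> \<in> homotopy_classes"
    and "is_matrix_of \<beta> A"
  shows "borsuk_ulam_property \<beta> tau2 \<longleftrightarrow>
    (A $ 1 $ 1, A $ 2 $ 1) \<noteq> (0, 0) \<and> even (A $ 1 $ 2) \<and> even (A $ 2 $ 2)"
proof -
  define a :: "real \<times> real" where "a = (of_int (A $ 2 $ 2), of_int (A $ 1 $ 2))"
  define b :: "real \<times> real" where "b = (of_int (A $ 2 $ 1), of_int (A $ 1 $ 1))"
  have lat: "a \<in> \<int> \<times> \<int>" "b \<in> \<int> \<times> \<int>"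
    by (simp_all add: a_def b_def)
  have parity: "a /\<^sub>R 2 \<in> \<int> \<times> \<int> \<longleftrightarrow> even (A $ 1 $ 2) \<and> even (A $ 2 $ 2)"
    using half_int_in_Ints_iff by (auto simp: a_def)
  have b0: "b \<noteq> 0 \<longleftrightarrow> (A $ 1 $ 1, A $ 2 $ 1) \<noteq> (0, 0)"
    by (auto simp: b_def zero_prod_def)
  have lift: "\<exists>F. continuous_on UNIV F \<and> (\<forall>v. to_torus (F v) = f (to_torus v)) \<and>
      (\<forall>v. F (v + (1, 0)) = F v + a) \<and> (\<forall>v. F (v + (0, 1)) = F v + b)"
    if f: "f \<in> \<beta>" "continuous_on UNIV f" for f
  proof -
    have "continuous_on UNIV (\<lambda>v. f (to_torus v))"
      by (rule continuous_on_compose2[OF f(2) continuous_on_to_torus]) simp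
    then obtain F where F: "continuous_on UNIV F" "\<And>v. to_torus (F v) = f (to_torus v)"
      using torus_map_lift[of UNIV] by (metis UNIV_I contractible_UNIV)
    then show ?thesis
      using assms(2) induced_hom_displacement[OF f F, of 0 1 "A $ 1 $ 2" "A $ 2 $ 2"]
        induced_hom_displacement[OF f F, of 1 0 "A $ 1 $ 1" "A $ 2 $ 1"]
      unfolding is_matrix_of_def a_def b_def by auto
  qed
  obtain f0 where f0: "continuous_on UNIV f0"
    and \<beta>: "\<beta> = {g. homotopic_with_canon (\<lambda>_. True) UNIV UNIV f0 g}"
    using assms(1) by (auto simp: homotopy_classes_def quotient_def)
  show ?thesis
    unfolding parity[symmetric] b0[symmetric]
  proof
    assume ab: "b \<noteq> 0 \<and> a /\<^sub>R 2 \<in> \<int> \<times> \<int>"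
    show "borsuk_ulam_property \<beta> tau2"
      unfolding borsuk_ulam_property_def
    proof (intro allI impI)
      fix f assume "continuous_on UNIV f \<and> f \<in> \<beta>"
      then obtain F where F: "continuous_on UNIV F" "\<forall>v. to_torus (F v) = f (to_torus v)"
        "\<forall>v. F (v + (1, 0)) = F v + a" "\<forall>v. F (v + (0, 1)) = F v + b"
        using lift by blast
      obtain v where "F (glide v) - F v \<in> \<int> \<times> \<int>"
        using glide_difference_hits_lattice[OF F(1) spec[OF F(3)] spec[OF F(4)]] ab lat(2) by metis
      then have "f (tau2 (to_torus v)) = f (to_torus v)"
        unfolding coincidence_iff_lattice[of F f, OF spec[OF F(2)]] .
      then show "\<exists>x. f (tau2 x) = f x"
        by blast
    qed
  next
    assume BU: "borsuk_ulam_property \<beta> tau2"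
    show "b \<noteq> 0 \<and> a /\<^sub>R 2 \<in> \<int> \<times> \<int>"
    proof (rule ccontr)
      assume "\<not> (b \<noteq> 0 \<and> a /\<^sub>R 2 \<in> \<int> \<times> \<int>)"
      then have ab: "b = 0 \<or> a /\<^sub>R 2 \<notin> \<int> \<times> \<int>"
        by (simp only: de_Morgan_conj not_not)
      have "f0 \<in> \<beta>"
        using f0 by (simp add: \<beta>)
      then obtain F where F: "continuous_on UNIV F" "\<forall>v. to_torus (F v) = f0 (to_torus v)"
        "\<forall>v. F (v + (1, 0)) = F v + a" "\<forall>v. F (v + (0, 1)) = F v + b"
        using lift f0 by blast
      obtain g where g: "homotopic_with_canon (\<lambda>_. True) UNIV UNIV f0 g" "\<And>x. g (tau2 x) \<noteq> g x"
        using coincidence_free_homotopic_map[OF F(1) spec[OF F(2)] spec[OF F(3)] spec[OF F(4)] lat ab]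
        by metis
      then have "continuous_on UNIV g" "g \<in> \<beta>"
        using homotopic_with_imp_continuous[OF g(1)] g(1) by (simp_all add: \<beta>)
      then show False
        using BU g(2) unfolding borsuk_ulam_property_def by blast
    qed
  qed
qed

end
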